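(* Let $R$ be a nonzero associative ring with identity. The following statements are equivalent. (1) For each $a\in R$, $P_a\subseteq r(l(RaR))$. (2) The ring $R$ is semiprime. (3) For all $a,b\in R$, $P_b\subseteq P_a$ implies $l(RaR)\subseteq l(RbR)$. (4) Every right $d$-ideal of $R$ is a $z^{\circ}$-ideal of $R$. (5) Every right annihilator ideal of $R$ is a $z^{\circ}$-ideal of $R$.
   Context: "Ideal" means two-sided ideal. For a subset $X\subseteq R$, $l(X)=\{r\in R: rX=0\}$ and $r(X)=\{r\in R: Xr=0\}$ are the left and right annihilators of $X$ in $R$. $RaR$ is the two-sided ideal generated by $a$. For $a\in R$, $P_a$ is the intersection of all minimal prime ideals of $R$ containing $a$ (an empty intersection is $R$). An ideal $I$ of $R$ is a $z^{\circ}$-ideal if $P_a\subseteq I$ for every $a\in I$. An ideal $I$ of $R$ is a right $d$-ideal if $r(l(RaR))\subseteq I$ for each $a\in I$. An ideal $I$ of $R$ is a right annihilator ideal if $r(l(I))=I$. A ring is semiprime if its prime radical (the intersection of its prime ideals, equivalently of its minimal prime ideals) is zero. *)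

theory Defs
  imports "HOL-Algebra.Ideal_Product"
begin

(* Rings are associative and unital, but not assumed commutative; the predicate ideal
   of HOL-Algebra means two-sided ideal. *)

definition left_annihilator :: "('a, 'b) ring_scheme \<Rightarrow> 'a set \<Rightarrow> 'a set" where
  "left_annihilator R X = {r \<in> carrier R. \<forall>x\<in>X. r \<otimes>\<^bsub>R\<^esub> x = \<zero>\<^bsub>R\<^esub>}"

definition right_annihilator :: "('a, 'b) ring_scheme \<Rightarrow> 'a set \<Rightarrow> 'a set" where
  "right_annihilator R X = {r \<in> carrier R. \<forall>x\<in>X. x \<otimes>\<^bsub>R\<^esub> r = \<zero>\<^bsub>R\<^esub>}"

(* Primeness in the noncommutative sense, through products of ideals; the library's
   primeideal is elementwise and requires the ring to be commutative. *)
definition prime_ideal :: "('a, 'b) ring_scheme \<Rightarrow> 'a set \<Rightarrow> bool" where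
  "prime_ideal R P \<longleftrightarrow> ideal P R \<and> P \<noteq> carrier R \<and>
     (\<forall>I J. ideal I R \<longrightarrow> ideal J R \<longrightarrow> ideal_prod R I J \<subseteq> P \<longrightarrow> I \<subseteq> P \<or> J \<subseteq> P)"

definition minimal_prime_ideal :: "('a, 'b) ring_scheme \<Rightarrow> 'a set \<Rightarrow> bool" where
  "minimal_prime_ideal R P \<longleftrightarrow> prime_ideal R P \<and>
     (\<forall>Q. prime_ideal R Q \<longrightarrow> Q \<subseteq> P \<longrightarrow> Q = P)"

(* Intersecting with the carrier makes an empty intersection equal to the whole ring,
   here and in prime_radical. *)
definition minimal_prime_hull :: "('a, 'b) ring_scheme \<Rightarrow> 'a \<Rightarrow> 'a set" where
  "minimal_prime_hull R a = carrier R \<inter> \<Inter>{P. minimal_prime_ideal R P \<and> a \<in> P}"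

definition prime_radical :: "('a, 'b) ring_scheme \<Rightarrow> 'a set" where
  "prime_radical R = carrier R \<inter> \<Inter>{P. prime_ideal R P}"

definition semiprime_ring :: "('a, 'b) ring_scheme \<Rightarrow> bool" where
  "semiprime_ring R \<longleftrightarrow> prime_radical R = {\<zero>\<^bsub>R\<^esub>}"

definition z_circ_ideal :: "('a, 'b) ring_scheme \<Rightarrow> 'a set \<Rightarrow> bool" where
  "z_circ_ideal R I \<longleftrightarrow> ideal I R \<and> (\<forall>a\<in>I. minimal_prime_hull R a \<subseteq> I)"

definition right_d_ideal :: "('a, 'b) ring_scheme \<Rightarrow> 'a set \<Rightarrow> bool" where
  "right_d_ideal R I \<longleftrightarrow> ideal I R \<and>
     (\<forall>a\<in>I. right_annihilator R (left_annihilator R (Idl\<^bsub>R\<^esub> {a})) \<subseteq> I)"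

definition right_annihilator_ideal :: "('a, 'b) ring_scheme \<Rightarrow> 'a set \<Rightarrow> bool" where
  "right_annihilator_ideal R I \<longleftrightarrow> ideal I R \<and>
     right_annihilator R (left_annihilator R I) = I"

end

(* The annihilator I = l(RaR) satisfies I (RaR) = 0, so a prime ideal not containing a must
   contain I.  Hence I P_a lies in every minimal prime ideal.  By Zorn's lemma the minimal primes
   intersect in the prime radical, so (2) implies (1).  Conversely each of the
   conditions, applied to the element 0 or to the annihilator ideal 0, forces P_0 = 0, and P_0
   contains the prime radical. *)
theory Submission
  imports Defs
begin

context ring
begin

section \<open>Annihilators of two-sided ideals\<close>

lemma left_annihilator_ideal:
  assumes "ideal I R"
  shows "ideal (left_annihilator R I) R"
proof (rule idealI[OF ring_axioms])
  interpret I: ideal I R by fact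
  show "subgroup (left_annihilator R I) (add_monoid R)"
  proof (rule add.subgroupI)
    show "left_annihilator R I \<noteq> {}"
      using zero_closed I.Icarr l_null unfolding left_annihilator_def by blast
  qed (auto simp: left_annihilator_def l_distr l_minus)
  fix a x assume "a \<in> left_annihilator R I" and x: "x \<in> carrier R"
  then have a: "a \<in> carrier R" and *: "\<And>y. y \<in> I \<Longrightarrow> a \<otimes> y = \<zero>"
    by (auto simp: left_annihilator_def)
  show "x \<otimes> a \<in> left_annihilator R I"
    using a x * by (auto simp: left_annihilator_def m_assoc)
  \<comment> \<open>Here \<open>I\<close> must absorb left factors:
    \<open>(a \<otimes> x) \<otimes> y = a \<otimes> (x \<otimes> y)\<close> with
    \<open>x \<otimes> y\<close> again in \<open>I\<close>.\<close>
  show "a \<otimes> x \<in> left_annihilator R I"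
    using a x * by (auto simp: left_annihilator_def m_assoc I.I_l_closed)
qed

lemma right_annihilator_ideal:
  assumes "ideal I R"
  shows "ideal (right_annihilator R I) R"
proof (rule idealI[OF ring_axioms])
  interpret I: ideal I R by fact
  show "subgroup (right_annihilator R I) (add_monoid R)"
  proof (rule add.subgroupI)
    show "right_annihilator R I \<noteq> {}"
      using zero_closed I.Icarr r_null unfolding right_annihilator_def by blast
  qed (auto simp: right_annihilator_def r_distr r_minus)
  fix a x assume "a \<in> right_annihilator R I" and x: "x \<in> carrier R"
  then have a: "a \<in> carrier R" and *: "\<And>y. y \<in> I \<Longrightarrow> y \<otimes> a = \<zero>"
    by (auto simp: right_annihilator_def)
  show "a \<otimes> x \<in> right_annihilator R I"
    using a x * by (auto simp: right_annihilator_def m_assoc[symmetric])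
  show "x \<otimes> a \<in> right_annihilator R I"
    using a x * by (auto simp: right_annihilator_def m_assoc[symmetric] I.I_r_closed)
qed

lemma left_annihilator_zero: "left_annihilator R {\<zero>} = carrier R"
  by (auto simp: left_annihilator_def)

lemma right_annihilator_carrier: "right_annihilator R (carrier R) = {\<zero>}"
proof
  show "right_annihilator R (carrier R) \<subseteq> {\<zero>}"
    using one_closed l_one unfolding right_annihilator_def by fastforce
qed (simp add: right_annihilator_def)

lemma ideal_prod_left_annihilator:
  assumes "ideal I R"
  shows "ideal_prod R (left_annihilator R I) I \<subseteq> {\<zero>}"
proof
  fix s assume "s \<in> ideal_prod R (left_annihilator R I) I"
  then show "s \<in> {\<zero>}"
    by induct (auto simp: left_annihilator_def)
qed

section \<open>Existence of minimal primes and the prime radical\<close>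

text \<open>If \<open>I\<close> is not inside \<open>P\<close> and \<open>J\<close> is not inside
  \<open>Q\<close>, the smaller of \<open>P\<close> and \<open>Q\<close> contains neither, against
  its primeness. This supplies the lower bounds for Zorn's lemma.\<close>

lemma prime_ideal_Inter_chain:
  assumes ne: "C \<noteq> {}" and prime: "\<And>P. P \<in> C \<Longrightarrow> prime_ideal R P"
    and chain: "\<And>P Q. P \<in> C \<Longrightarrow> Q \<in> C \<Longrightarrow> P \<subseteq> Q \<or> Q \<subseteq> P"
  shows "prime_ideal R (\<Inter>C)"
  unfolding prime_ideal_def
proof (intro conjI allI impI)
  show "ideal (\<Inter>C) R"
    using ne prime by (intro i_Intersect) (auto simp: prime_ideal_def)
  from ne obtain P where P: "P \<in> C" by blast
  then have "P \<subseteq> carrier R" "P \<noteq> carrier R"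
    using prime[OF P] by (auto simp: prime_ideal_def dest: ideal.Icarr)
  with P show "\<Inter>C \<noteq> carrier R" by blast
  fix I J assume I: "ideal I R" and J: "ideal J R" and sub: "ideal_prod R I J \<subseteq> \<Inter>C"
  have *: "I \<subseteq> P \<or> J \<subseteq> P" if "P \<in> C" for P
    using prime[OF that] I J sub that unfolding prime_ideal_def by blast
  show "I \<subseteq> \<Inter>C \<or> J \<subseteq> \<Inter>C"
  proof (rule ccontr)
    assume "\<not> ?thesis"
    then obtain P Q where "P \<in> C" "\<not> I \<subseteq> P" "Q \<in> C" "\<not> J \<subseteq> Q" by blast
    with * chain[of P Q] show False by blast
  qed
qed

lemma minimal_prime_ideal_below:
  assumes P: "prime_ideal R P"
  obtains Q where "minimal_prime_ideal R Q" "Q \<subseteq> P"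
proof -
  let ?A = "{Q. prime_ideal R Q \<and> Q \<subseteq> P}"
  have "\<exists>M\<in>?A. \<forall>Q\<in>?A. Q \<subseteq> M \<longrightarrow> Q = M"
  \<comment> \<open>The order is reversed inclusion, so a Zorn-maximal element is a minimal prime
    and upper bounds are intersections.\<close>
  proof (rule predicate_Zorn)
    show "partial_order_on ?A (relation_of (\<lambda>X Y. Y \<subseteq> X) ?A)"
      by (rule partial_order_on_relation_ofI) auto
    fix C assume "C \<in> Chains (relation_of (\<lambda>X Y. Y \<subseteq> X) ?A)"
    then have CA: "C \<subseteq> ?A" and chain: "\<And>X Y. X \<in> C \<Longrightarrow> Y \<in> C \<Longrightarrow> X \<subseteq> Y \<or> Y \<subseteq> X"
      by (auto simp: Chains_def relation_of_def)
    show "\<exists>U\<in>?A. \<forall>X\<in>C. U \<subseteq> X"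
    proof (cases "C = {}")
      \<comment> \<open>The intersection of the empty chain would be the universal set, so
        \<open>P\<close> itself serves as the bound.\<close>
      case True
      with P show ?thesis by auto
    next
      case False
      then have "prime_ideal R (\<Inter>C)"
        using CA chain by (intro prime_ideal_Inter_chain) auto
      moreover have "\<Inter>C \<subseteq> P"
        using False CA by blast
      ultimately show ?thesis by blast
    qed
  qed
  then obtain M where MA: "M \<in> ?A" and min: "\<forall>Q\<in>?A. Q \<subseteq> M \<longrightarrow> Q = M" ..
  then have M: "prime_ideal R M" "M \<subseteq> P" by simp_all
  \<comment> \<open>Minimality in \<open>?A\<close> is minimality among all primes, since a prime
    below \<open>M\<close> also lies below \<open>P\<close>.\<close>
  have "minimal_prime_ideal R M"
    unfolding minimal_prime_ideal_def using M min by (metis (mono_tags) mem_Collect_eq subset_trans)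
  then show thesis
    using M(2) by (rule that)
qed

lemma zero_in_minimal_prime_ideal: "minimal_prime_ideal R P \<Longrightarrow> \<zero> \<in> P"
  by (simp add: minimal_prime_ideal_def prime_ideal_def ideal_def additive_subgroup.zero_closed)

text \<open>Every minimal prime contains zero, and every prime contains a minimal one, so both
  intersections agree.\<close>

lemma minimal_prime_hull_zero: "minimal_prime_hull R \<zero> = prime_radical R"
proof
  show "minimal_prime_hull R \<zero> \<subseteq> prime_radical R"
    unfolding minimal_prime_hull_def prime_radical_def
    using minimal_prime_ideal_below zero_in_minimal_prime_ideal by blast
  show "prime_radical R \<subseteq> minimal_prime_hull R \<zero>"
    by (auto simp: minimal_prime_hull_def prime_radical_def minimal_prime_ideal_def)
qed

lemma semiprime_ringI:
  assumes "minimal_prime_hull R \<zero> \<subseteq> {\<zero>}"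
  shows "semiprime_ring R"
  using assms zero_in_minimal_prime_ideal
  by (auto simp: semiprime_ring_def minimal_prime_hull_zero[symmetric] minimal_prime_hull_def)

section \<open>Semiprimeness and the equivalent conditions\<close>

lemma minimal_prime_hull_subset_annihilator:
  assumes "semiprime_ring R" and a: "a \<in> carrier R"
  shows "minimal_prime_hull R a \<subseteq> right_annihilator R (left_annihilator R (Idl {a}))"
proof
  fix x assume x: "x \<in> minimal_prime_hull R a"
  then have xc: "x \<in> carrier R" by (simp add: minimal_prime_hull_def)
  let ?L = "left_annihilator R (Idl {a})"
  have Ia: "ideal (Idl {a}) R" using a by (simp add: genideal_ideal)
  have L: "ideal ?L R" using Ia by (rule left_annihilator_ideal)
  have "y \<otimes> x = \<zero>" if y: "y \<in> ?L" for y
  proof -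
    have yc: "y \<in> carrier R" using y by (simp add: left_annihilator_def)
    \<comment> \<open>Primeness puts either \<open>y\<close> into \<open>P\<close>, or
      \<open>a\<close> and hence \<open>x\<close>, because \<open>x\<close> lies in every minimal
      prime containing \<open>a\<close>.\<close>
    have "y \<otimes> x \<in> P" if P: "minimal_prime_ideal R P" for P
    proof -
      have "prime_ideal R P" using P by (simp add: minimal_prime_ideal_def)
      then have PI: "ideal P R" and
        prime: "\<And>I J. ideal I R \<Longrightarrow> ideal J R \<Longrightarrow> ideal_prod R I J \<subseteq> P \<Longrightarrow> I \<subseteq> P \<or> J \<subseteq> P"
        by (auto simp: prime_ideal_def)
      have "ideal_prod R ?L (Idl {a}) \<subseteq> P"
        using ideal_prod_left_annihilator[OF Ia] zero_in_minimal_prime_ideal[OF P] by blast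
      then consider "?L \<subseteq> P" | "Idl {a} \<subseteq> P"
        using prime[OF L Ia] by blast
      then show ?thesis
      proof cases
        case 1
        with y PI xc show ?thesis by (blast intro: ideal.I_r_closed)
      next
        case 2
        then have "x \<in> P"
          using x P genideal_self'[OF a] by (auto simp: minimal_prime_hull_def)
        with PI yc show ?thesis by (blast intro: ideal.I_l_closed)
      qed
    qed
    then have "y \<otimes> x \<in> minimal_prime_hull R \<zero>"
      using xc yc by (auto simp: minimal_prime_hull_def)
    then show ?thesis
      using assms(1) by (simp add: minimal_prime_hull_zero semiprime_ring_def)
  qed
  with xc show "x \<in> right_annihilator R ?L"
    by (simp add: right_annihilator_def)
qed

lemma semiprime_iff_hull_subset_annihilator:
  "semiprime_ring R \<longleftrightarrow> (\<forall>a\<in>carrier R.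
     minimal_prime_hull R a \<subseteq> right_annihilator R (left_annihilator R (Idl {a})))"
proof
  assume "\<forall>a\<in>carrier R.
    minimal_prime_hull R a \<subseteq> right_annihilator R (left_annihilator R (Idl {a}))"
  from bspec[OF this zero_closed] show "semiprime_ring R"
    by (intro semiprime_ringI)
      (simp add: genideal_zero left_annihilator_zero right_annihilator_carrier)
qed (use minimal_prime_hull_subset_annihilator in blast)

text \<open>Forward, \<open>b\<close> lies in its own hull, hence in the hull of \<open>a\<close>
  and in the ideal \<open>r(l(RaR))\<close>. That ideal then contains \<open>RbR\<close>, which says
  that \<open>l(RaR)\<close> annihilates \<open>RbR\<close>.\<close>

lemma semiprime_iff_annihilator_antimono:
  "semiprime_ring R \<longleftrightarrow> (\<forall>a\<in>carrier R. \<forall>b\<in>carrier R.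
     minimal_prime_hull R b \<subseteq> minimal_prime_hull R a \<longrightarrow>
     left_annihilator R (Idl {a}) \<subseteq> left_annihilator R (Idl {b}))"
  (is "_ \<longleftrightarrow> ?antimono")
proof
  assume sp: "semiprime_ring R"
  show ?antimono
  proof (intro ballI impI)
    fix a b assume a: "a \<in> carrier R" and b: "b \<in> carrier R"
      and sub: "minimal_prime_hull R b \<subseteq> minimal_prime_hull R a"
    let ?L = "left_annihilator R (Idl {a})"
    have "ideal ?L R"
      using a by (simp add: genideal_ideal left_annihilator_ideal)
    then have "ideal (right_annihilator R ?L) R"
      by (rule right_annihilator_ideal)
    moreover have "b \<in> right_annihilator R ?L"
      using sub minimal_prime_hull_subset_annihilator[OF sp a] b
      by (auto simp: minimal_prime_hull_def)
    ultimately have "Idl {b} \<subseteq> right_annihilator R ?L"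
      by (simp add: genideal_minimal)
    then show "?L \<subseteq> left_annihilator R (Idl {b})"
      by (auto simp: left_annihilator_def right_annihilator_def)
  qed
next
  assume antimono: ?antimono
  show "semiprime_ring R"
  proof (intro semiprime_ringI subsetI)
    fix x assume x: "x \<in> minimal_prime_hull R \<zero>"
    then have xc: "x \<in> carrier R" by (simp add: minimal_prime_hull_def)
    \<comment> \<open>As \<open>x\<close> lies in every minimal prime, its hull is the intersection
      of all of them. The hypothesis with \<open>a = \<zero>\<close> and \<open>b = x\<close> then
      makes \<open>\<one>\<close> annihilate \<open>x\<close>.\<close>
    have "minimal_prime_hull R x \<subseteq> minimal_prime_hull R \<zero>"
      using x by (auto simp: minimal_prime_hull_def)
    with antimono xc have "carrier R \<subseteq> left_annihilator R (Idl {x})"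
      by (metis genideal_zero left_annihilator_zero zero_closed)
    with one_closed genideal_self'[OF xc] have "\<one> \<otimes> x = \<zero>"
      by (auto simp: left_annihilator_def)
    with xc show "x \<in> {\<zero>}" by simp
  qed
qed

text \<open>Both annihilators reverse inclusions, so \<open>r(l(_))\<close> is monotone and can be
  applied to \<open>RaR \<subseteq> I\<close>. This makes condition (5) a special case of
  (4).\<close>

lemma right_annihilator_ideal_imp_right_d_ideal:
  assumes "right_annihilator_ideal R I"
  shows "right_d_ideal R I"
proof -
  have I: "ideal I R" and eq: "right_annihilator R (left_annihilator R I) = I"
    using assms by (auto simp: right_annihilator_ideal_def)
  have "right_annihilator R (left_annihilator R (Idl {a})) \<subseteq> I" if "a \<in> I" for a
  proof -
    have "Idl {a} \<subseteq> I" using I that by (simp add: genideal_minimal)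
    then have "right_annihilator R (left_annihilator R (Idl {a}))
        \<subseteq> right_annihilator R (left_annihilator R I)"
      by (auto simp: left_annihilator_def right_annihilator_def)
    with eq show ?thesis by simp
  qed
  with I show ?thesis by (simp add: right_d_ideal_def)
qed

text \<open>For \<open>a\<close> in \<open>I\<close>, the chain is
  \<open>P_a \<subseteq> r(l(RaR)) \<subseteq> I\<close>.\<close>

lemma semiprime_imp_right_d_ideal_z_circ:
  assumes "semiprime_ring R" "right_d_ideal R I"
  shows "z_circ_ideal R I"
  using assms minimal_prime_hull_subset_annihilator
  unfolding right_d_ideal_def z_circ_ideal_def by (meson ideal.Icarr subset_trans)

lemma semiprime_if_right_annihilator_ideals_z_circ:
  assumes "\<And>I. right_annihilator_ideal R I \<Longrightarrow> z_circ_ideal R I"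
  shows "semiprime_ring R"
proof (rule semiprime_ringI)
  \<comment> \<open>The zero ideal is a right annihilator ideal: its left annihilator is the whole
    ring, and the identity forces \<open>r(R) = 0\<close>.\<close>
  have "z_circ_ideal R {\<zero>}"
    by (rule assms) (simp add: right_annihilator_ideal_def zeroideal
        left_annihilator_zero right_annihilator_carrier)
  then show "minimal_prime_hull R \<zero> \<subseteq> {\<zero>}"
    by (simp add: z_circ_ideal_def)
qed

end

theorem proposition3p2:
  fixes R :: "('a, 'b) ring_scheme"
  assumes "ring R" and "carrier R \<noteq> {\<zero>\<^bsub>R\<^esub>}"
  shows "((\<forall>a\<in>carrier R. minimal_prime_hull R a \<subseteq>
              right_annihilator R (left_annihilator R (Idl\<^bsub>R\<^esub> {a})))
            \<longleftrightarrow> semiprime_ring R)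
       \<and> (semiprime_ring R
            \<longleftrightarrow> (\<forall>a\<in>carrier R. \<forall>b\<in>carrier R.
                   minimal_prime_hull R b \<subseteq> minimal_prime_hull R a \<longrightarrow>
                   left_annihilator R (Idl\<^bsub>R\<^esub> {a}) \<subseteq> left_annihilator R (Idl\<^bsub>R\<^esub> {b})))
       \<and> (semiprime_ring R
            \<longleftrightarrow> (\<forall>I. right_d_ideal R I \<longrightarrow> z_circ_ideal R I))
       \<and> (semiprime_ring R
            \<longleftrightarrow> (\<forall>I. right_annihilator_ideal R I \<longrightarrow> z_circ_ideal R I))"
proof -
  interpret ring R by fact
  show ?thesis
  proof (intro conjI)
    \<comment> \<open>The cycle is (2) to (4) to (5) to (2).\<close>
    show "semiprime_ring R \<longleftrightarrow> (\<forall>I. right_d_ideal R I \<longrightarrow> z_circ_ideal R I)"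
      using semiprime_imp_right_d_ideal_z_circ semiprime_if_right_annihilator_ideals_z_circ
        right_annihilator_ideal_imp_right_d_ideal by blast
    show "semiprime_ring R \<longleftrightarrow> (\<forall>I. right_annihilator_ideal R I \<longrightarrow> z_circ_ideal R I)"
      using semiprime_imp_right_d_ideal_z_circ semiprime_if_right_annihilator_ideals_z_circ
        right_annihilator_ideal_imp_right_d_ideal by blast
  qed (use semiprime_iff_hull_subset_annihilator semiprime_iff_annihilator_antimono in simp_all)
qed

end
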